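(* The clairvoyance gap for scheduling on related machines is $\Theta(\sqrt m)$, where $m$ is the number of machines.
   Context: Scheduling (load balancing) on related machines: there are $m$ machines with speeds $s_i>0$ and a set of jobs with sizes $p_j\ge0$; assigning job $j$ to machine $i$ adds $p_j/s_i$ to the load of machine $i$, and the makespan is the maximum machine load. A non-clairvoyant algorithm has no prior knowledge of job sizes: it decides on which machine to place each job using only the current machine loads and speeds; after the algorithm assigns a job, an adversary chooses the job's realized size, which the algorithm then observes for subsequent decisions. The clairvoyance gap is the maximum (over instances with $m$ machines) ratio between the makespan of an optimal non-clairvoyant algorithm and the optimal makespan achievable by a clairvoyant offline algorithm that knows all jobs and their sizes in advance. *)

theory Defs
  imports Complex_Main "HOL-Library.Extended_Real" "HOL-Library.Landau_Symbols"
begin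

text \<open>
  Machines are \<open>0, \<dots>, m - 1\<close>; speeds and loads are lists of length \<open>m\<close>.
  A schedule is the list of pairs (machine, size) of the jobs assigned so far, in order of
  assignment.
\<close>

type_synonym schedule = "(nat \<times> real) list"

definition speeds :: "nat \<Rightarrow> real list set" where
  "speeds m = {s. length s = m \<and> (\<forall>i<m. 0 < s ! i)}"

definition load :: "real list \<Rightarrow> schedule \<Rightarrow> nat \<Rightarrow> real" where
  "load s h i = (\<Sum>(k, p)\<leftarrow>h. if k = i then p / s ! i else 0)"

definition loads :: "real list \<Rightarrow> schedule \<Rightarrow> real list" where
  "loads s h = map (load s h) [0..<length s]"

definition makespan :: "real list \<Rightarrow> schedule \<Rightarrow> real" where
  "makespan s h = Max (load s h ` {..<length s})"

definition opt_makespan :: "real list \<Rightarrow> real list \<Rightarrow> real" where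
  "opt_makespan s ps =
     Min ((\<lambda>as. makespan s (zip as ps)) ` {as. length as = length ps \<and> set as \<subseteq> {..<length s}})"

text \<open>
  A non-clairvoyant algorithm maps the speeds and the current loads to the machine that
  receives the next job.
\<close>

type_synonym algorithm = "real list \<Rightarrow> real list \<Rightarrow> nat"

definition nonclairvoyant_algorithms :: "nat \<Rightarrow> algorithm set" where
  "nonclairvoyant_algorithms m =
     {A. \<forall>s\<in>speeds m. \<forall>l. length l = m \<longrightarrow> A s l < m}"

text \<open>
  An adversary maps the schedule so far and the machine just chosen for the next job
  to the realized size of that job.
\<close>

type_synonym adversary = "schedule \<Rightarrow> nat \<Rightarrow> real"

definition adversaries :: "adversary set" where
  "adversaries = {B. \<forall>h i. 0 \<le> B h i}"

primrec play :: "algorithm \<Rightarrow> adversary \<Rightarrow> real list \<Rightarrow> nat \<Rightarrow> schedule" where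
  "play A B s 0 = []"
| "play A B s (Suc n) =
     (let h = play A B s n; i = A s (loads s h) in h @ [(i, B h i)])"

text \<open>
  The sizes, hence the instance, are only determined during play, so an optimal algorithm is one
  that minimises the worst case over the speeds, the number of jobs and the adversary.
  If all sizes are \<open>0\<close>, both makespans are \<open>0\<close> and the ratio is \<open>0 / 0 = 0\<close>,
  which does not affect the supremum.
\<close>

definition makespan_ratio :: "algorithm \<Rightarrow> adversary \<Rightarrow> real list \<Rightarrow> nat \<Rightarrow> real" where
  "makespan_ratio A B s n =
     (let h = play A B s n in makespan s h / opt_makespan s (map snd h))"

definition clairvoyance_gap :: "nat \<Rightarrow> ereal" where
  "clairvoyance_gap m =
     (INF A\<in>nonclairvoyant_algorithms m.
        SUP (s, n, B)\<in>speeds m \<times> UNIV \<times> adversaries. ereal (makespan_ratio A B s n))"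

end

theory Submission
  imports Defs
begin

text \<open>
  Upper bound: call a machine fast if its speed is at least \<open>1 / sqrt m\<close> times the maximal
  speed, and always use a least loaded fast machine. The discarded machines have total speed at
  most \<open>sqrt m\<close> times the maximal speed, so the least load among the fast machines is at
  most \<open>(1 + sqrt m) * OPT\<close>, and one further job adds at most \<open>sqrt m * OPT\<close>.

  Lower bound: take one machine of speed \<open>sqrt m\<close> and \<open>m - 1\<close> machines of speed
  \<open>1\<close>. Jobs put on the former get size \<open>1\<close>, and the first job put on one of the
  latter gets size \<open>sqrt m\<close> and ends the play; there are at most \<open>m - 1\<close> jobs.
  In hindsight, the unit jobs fit on distinct slow machines and the large one on the fast machine,
  so \<open>OPT \<le> 1\<close>.
\<close>

subsection \<open>Loads and makespans\<close>

lemma load_Nil [simp]: "load s [] i = 0"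
  by (simp add: load_def)

lemma load_Cons: "load s (x # h) i = (if fst x = i then snd x / s ! i else 0) + load s h i"
  by (cases x) (simp add: load_def)

lemma load_append: "load s (h @ h') i = load s h i + load s h' i"
  by (simp add: load_def)

lemma load_nonneg:
  assumes "\<forall>p\<in>snd ` set h. 0 \<le> p" "0 < s ! i"
  shows "0 \<le> load s h i"
  using assms by (induction h) (auto simp: load_Cons)

lemma size_le_load:
  assumes "\<forall>p\<in>snd ` set h. 0 \<le> p" "0 < s ! i" "(i, p) \<in> set h"
  shows "p / s ! i \<le> load s h i"
  using assms
proof (induction h)
  case (Cons x h)
  have "0 \<le> load s h i" using Cons.prems by (intro load_nonneg) auto
  with Cons show ?case by (auto simp: load_Cons intro: add_increasing)
qed simp

text \<open>A job of size \<open>p\<close> on machine \<open>i\<close> adds \<open>p / s ! i\<close>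
  to its load, and weighting by the speed restores \<open>p\<close>. This links loads to total
  volume.\<close>

lemma sum_sizes_eq:
  assumes "\<forall>i<length s. 0 < s ! i" "fst ` set h \<subseteq> {..<length s}"
  shows "sum_list (map snd h) = (\<Sum>i<length s. s ! i * load s h i)"
  using assms(2)
proof (induction h)
  case (Cons x h)
  have "(\<Sum>i<length s. s ! i * load s (x # h) i) =
    (\<Sum>i<length s. (if fst x = i then snd x else 0) + s ! i * load s h i)"
    using assms(1) by (intro sum.cong) (auto simp: load_Cons algebra_simps)
  also have "\<dots> = snd x + (\<Sum>i<length s. s ! i * load s h i)"
    using Cons.prems by (simp add: sum.distrib)
  finally show ?case using Cons by simp
qed simp

lemma load_le_makespan: "i < length s \<Longrightarrow> load s h i \<le> makespan s h"
  by (simp add: makespan_def)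

lemma makespan_le:
  assumes "0 < length s" "\<And>i. i < length s \<Longrightarrow> load s h i \<le> c"
  shows "makespan s h \<le> c"
  unfolding makespan_def using assms by (subst Max_le_iff) auto

section \<open>Optimal makespan: attainment, lower bounds, and a certificate for the bound 1\<close>

lemma finite_assignments: "finite {as. length as = n \<and> set as \<subseteq> {..<k::nat}}"
  using finite_lists_length_eq[of "{..<k}" n] by (simp add: conj_commute)

lemma opt_makespan_le:
  assumes "length as = length ps" "set as \<subseteq> {..<length s}"
  shows "opt_makespan s ps \<le> makespan s (zip as ps)"
  unfolding opt_makespan_def using assms
  by (intro Min_le finite_imageI finite_assignments) auto

lemma opt_makespan_attained:
  assumes "0 < length s"
  obtains as where "length as = length ps" "set as \<subseteq> {..<length s}"
    "opt_makespan s ps = makespan s (zip as ps)"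
proof -
  let ?S = "{as. length as = length ps \<and> set as \<subseteq> {..<length s}}"
  have "replicate (length ps) 0 \<in> ?S" using assms by (auto simp: set_replicate_conv_if)
  hence "opt_makespan s ps \<in> (\<lambda>as. makespan s (zip as ps)) ` ?S"
    unfolding opt_makespan_def by (intro Min_in finite_imageI finite_assignments) blast
  thus ?thesis using that by auto
qed

text \<open>In an optimal assignment all loads lie between 0 and the optimum. Weighting them by the
  speeds gives the volume bound; the machine hosting a job, no faster than the fastest one, gives
  the size bound.\<close>

lemma opt_makespan_lower_bounds:
  assumes s: "s \<in> speeds m" and m: "1 \<le> m" and ps: "\<forall>p\<in>set ps. 0 \<le> p"
  shows "0 \<le> opt_makespan s ps"
    and "sum_list ps \<le> opt_makespan s ps * (\<Sum>i<m. s ! i)"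
    and "\<forall>p\<in>set ps. p \<le> opt_makespan s ps * Max (set s)"
proof -
  have len: "length s = m" and pos: "\<And>i. i < m \<Longrightarrow> 0 < s ! i"
    using s by (auto simp: speeds_def)
  obtain as where as: "length as = length ps" "set as \<subseteq> {..<length s}"
    and opt: "opt_makespan s ps = makespan s (zip as ps)"
    using opt_makespan_attained[of s ps] m len by auto
  let ?h = "zip as ps"
  have snd_h: "map snd ?h = ps" and fst_h: "map fst ?h = as" using as by simp_all
  have h0: "\<forall>p\<in>snd ` set ?h. 0 \<le> p"
    using ps by (auto dest: set_zip_rightD)
  have l0: "0 \<le> load s ?h i" if "i < m" for i
    using that h0 pos by (intro load_nonneg) auto
  have lM: "load s ?h i \<le> opt_makespan s ps" if "i < m" for i
    using that len opt load_le_makespan by simp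
  show nonneg: "0 \<le> opt_makespan s ps" using l0[of 0] lM[of 0] m by auto
  have "fst ` set ?h \<subseteq> {..<length s}" using as fst_h by (metis set_map)
  hence "sum_list ps = (\<Sum>i<m. s ! i * load s ?h i)"
    using sum_sizes_eq[of s ?h] pos len snd_h by simp
  also have "\<dots> \<le> (\<Sum>i<m. s ! i * opt_makespan s ps)"
    using lM pos by (intro sum_mono mult_left_mono) (auto intro: less_imp_le)
  finally show "sum_list ps \<le> opt_makespan s ps * (\<Sum>i<m. s ! i)"
    by (simp add: sum_distrib_left mult.commute)
  show "\<forall>p\<in>set ps. p \<le> opt_makespan s ps * Max (set s)"
  proof
    fix p assume "p \<in> set ps"
    hence "p \<in> snd ` set ?h" using snd_h by (metis set_map)
    then obtain i where i: "(i, p) \<in> set ?h" by auto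
    hence im: "i < m" using as len by (auto dest: set_zip_leftD)
    have "p / s ! i \<le> opt_makespan s ps"
      using size_le_load[OF h0 pos[OF im] i] lM[OF im] by simp
    hence "p \<le> opt_makespan s ps * s ! i" using pos[OF im] by (simp add: field_simps)
    also have "\<dots> \<le> opt_makespan s ps * Max (set s)"
      using nonneg im len by (intro mult_left_mono) auto
    finally show "p \<le> opt_makespan s ps * Max (set s)" .
  qed
qed

text \<open>The sharper bound 0 on machines without a job carries the induction: a new job always
  meets an empty machine.\<close>

lemma load_le_1_if_distinct:
  assumes "distinct (map fst h)" "0 < s ! i" "\<forall>(k, p)\<in>set h. p \<le> s ! k"
  shows "load s h i \<le> (if i \<in> fst ` set h then 1 else 0)"
  using assms
proof (induction h)
  case (Cons x h)
  have "snd x / s ! i \<le> 1" if "fst x = i" using Cons.prems that by (cases x) simp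
  moreover have "load s h i \<le> (if i \<in> fst ` set h then 1 else 0)"
    using Cons by simp
  ultimately show ?case using Cons.prems(1) by (cases "fst x = i") (auto simp: load_Cons)
qed simp

lemma opt_makespan_le_1:
  assumes "s \<in> speeds m" "1 \<le> m" "distinct as" "length as = length ps" "set as \<subseteq> {..<m}"
    "\<And>j. j < length ps \<Longrightarrow> ps ! j \<le> s ! (as ! j)"
  shows "opt_makespan s ps \<le> 1"
proof -
  have len: "length s = m" and pos: "\<And>i. i < m \<Longrightarrow> 0 < s ! i"
    using assms by (auto simp: speeds_def)
  have "opt_makespan s ps \<le> makespan s (zip as ps)"
    using assms len by (intro opt_makespan_le) auto
  also have "\<dots> \<le> 1"
  proof (rule makespan_le)
    fix i assume "i < length s"
    have "load s (zip as ps) i \<le> (if i \<in> fst ` set (zip as ps) then 1 else 0)"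
      using \<open>i < length s\<close> pos len assms
      by (intro load_le_1_if_distinct) (auto simp: set_zip)
    thus "load s (zip as ps) i \<le> 1" by (simp split: if_splits)
  qed (use len assms in simp)
  finally show ?thesis .
qed

section \<open>Invariants of a play\<close>

lemma play_sizes_nonneg:
  assumes "B \<in> adversaries"
  shows "\<forall>p\<in>snd ` set (play A B s n). 0 \<le> p"
  using assms by (induction n) (auto simp: Let_def adversaries_def)

lemma play_machines:
  assumes "A \<in> nonclairvoyant_algorithms m" "s \<in> speeds m"
  shows "fst ` set (play A B s n) \<subseteq> {..<m}"
proof (induction n)
  case (Suc n)
  have "A s (loads s (play A B s n)) < m"
    using assms by (auto simp: nonclairvoyant_algorithms_def loads_def speeds_def)
  with Suc show ?case by (auto simp: Let_def)
qed simp

lemma makespan_ratio_nonneg: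
  assumes "s \<in> speeds m" "1 \<le> m" "B \<in> adversaries"
  shows "0 \<le> makespan_ratio A B s n"
proof -
  let ?h = "play A B s n"
  have "length s = m" "0 < s ! 0" using assms by (auto simp: speeds_def)
  hence "0 \<le> makespan s ?h"
    using load_nonneg[of ?h s 0, OF play_sizes_nonneg[OF assms(3)]] assms
      load_le_makespan[of 0 s ?h] by auto
  moreover have "0 \<le> opt_makespan s (map snd ?h)"
    using opt_makespan_lower_bounds(1)[OF assms(1,2)] play_sizes_nonneg[OF assms(3)] by simp
  ultimately show ?thesis by (simp add: makespan_ratio_def Let_def)
qed

subsection \<open>Upper bound\<close>

text \<open>The threshold balances two losses: the total speed discarded and the slowdown of a
  single job on a fast machine. Both cost a factor of order \<open>sqrt m\<close>.\<close>

definition fast_machines :: "real list \<Rightarrow> nat set" where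
  "fast_machines s = {i. i < length s \<and> Max (set s) \<le> sqrt (length s) * s ! i}"

definition least_loaded_fast :: algorithm where
  "least_loaded_fast s l = arg_min_on ((!) l) (fast_machines s)"

lemma finite_fast_machines [simp]: "finite (fast_machines s)"
  by (simp add: fast_machines_def)

lemma fastest_machine:
  assumes "s \<in> speeds m" "1 \<le> m"
  obtains i where "i \<in> fast_machines s" "s ! i = Max (set s)"
proof -
  have s: "length s = m" "\<And>i. i < m \<Longrightarrow> 0 < s ! i" using assms by (auto simp: speeds_def)
  hence "Max (set s) \<in> set s" using assms by (intro Max_in) auto
  then obtain i where i: "i < m" "s ! i = Max (set s)" using s by (auto simp: in_set_conv_nth)
  have "1 * s ! i \<le> sqrt m * s ! i"
    using s(2)[OF i(1)] assms by (intro mult_right_mono) auto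
  hence "i \<in> fast_machines s" using i s by (simp add: fast_machines_def)
  thus ?thesis using that i by blast
qed

lemma least_loaded_fast_spec:
  assumes "s \<in> speeds m" "1 \<le> m"
  shows "least_loaded_fast s l \<in> fast_machines s"
    and "i \<in> fast_machines s \<Longrightarrow> l ! least_loaded_fast s l \<le> l ! i"
proof -
  have ne: "fast_machines s \<noteq> {}" using fastest_machine[OF assms] by blast
  show "least_loaded_fast s l \<in> fast_machines s"
    unfolding least_loaded_fast_def using ne by (intro arg_min_if_finite) auto
  show "l ! least_loaded_fast s l \<le> l ! i" if "i \<in> fast_machines s"
    unfolding least_loaded_fast_def using ne that by (intro arg_min_least) auto
qed

lemma least_loaded_fast_nonclairvoyant:
  assumes "1 \<le> m"
  shows "least_loaded_fast \<in> nonclairvoyant_algorithms m"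
  using least_loaded_fast_spec(1)[OF _ assms]
  by (fastforce simp: nonclairvoyant_algorithms_def fast_machines_def speeds_def)

text \<open>There are at most \<open>m\<close> slow machines, each slower than the maximal speed
  divided by \<open>sqrt m\<close>, so together they have at most \<open>sqrt m\<close> times the
  maximal speed. The fastest machine is itself fast, so the fast total absorbs this.\<close>

lemma sum_speeds_le_fast:
  assumes "s \<in> speeds m" "1 \<le> m"
  shows "(\<Sum>i<m. s ! i) \<le> (1 + sqrt m) * (\<Sum>i\<in>fast_machines s. s ! i)"
proof -
  have len: "length s = m" and pos: "\<And>i. i < m \<Longrightarrow> 0 < s ! i"
    using assms by (auto simp: speeds_def)
  let ?F = "fast_machines s" and ?v = "Max (set s)"
  have F: "?F \<subseteq> {..<m}" using len by (auto simp: fast_machines_def)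
  obtain f where f: "f \<in> ?F" "s ! f = ?v" using fastest_machine[OF assms] .
  have v0: "0 < ?v" using f F pos by (metis lessThan_iff subsetD)
  have v: "?v \<le> (\<Sum>i\<in>?F. s ! i)"
    using f(2) member_le_sum[OF f(1), of "(!) s"] F pos by (force intro: less_imp_le)
  have "(\<Sum>i\<in>{..<m} - ?F. s ! i) \<le> (\<Sum>i\<in>{..<m} - ?F. ?v / sqrt m)"
    using assms len by (intro sum_mono) (auto simp: fast_machines_def field_simps)
  also have "\<dots> = card ({..<m} - ?F) * (?v / sqrt m)" by simp
  also have "\<dots> \<le> m * (?v / sqrt m)"
    using v0 card_mono[of "{..<m}" "{..<m} - ?F"] by (intro mult_right_mono) auto
  also have "\<dots> = sqrt m * ?v" using assms by (simp add: field_simps)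
  also have "\<dots> \<le> sqrt m * (\<Sum>i\<in>?F. s ! i)" using v by (intro mult_left_mono) auto
  finally have "(\<Sum>i\<in>{..<m} - ?F. s ! i) \<le> sqrt m * (\<Sum>i\<in>?F. s ! i)" .
  moreover have "(\<Sum>i<m. s ! i) = (\<Sum>i\<in>{..<m} - ?F. s ! i) + (\<Sum>i\<in>?F. s ! i)"
    using F by (intro sum.subset_diff) auto
  ultimately show ?thesis by (simp add: algebra_simps)
qed

text \<open>\<open>T\<close> stands for the optimum of the whole play. Keeping it fixed makes the
  induction work: both hypotheses pass to prefixes, whereas the optimum changes with the number of
  jobs.\<close>

lemma load_least_loaded_fast_le:
  fixes T :: real
  assumes s: "s \<in> speeds m" and m: "1 \<le> m" and B: "B \<in> adversaries"
    and T: "0 \<le> T"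
    and "sum_list (map snd (play least_loaded_fast B s n)) \<le> T * (\<Sum>i<m. s ! i)"
    and "\<forall>p\<in>snd ` set (play least_loaded_fast B s n). p \<le> T * Max (set s)"
    and i: "i < m"
  shows "load s (play least_loaded_fast B s n) i \<le> (1 + 2 * sqrt m) * T"
  using assms(5,6)
proof (induction n)
  case 0
  thus ?case using T by simp
next
  case (Suc n)
  have len: "length s = m" and pos: "\<And>i. i < m \<Longrightarrow> 0 < s ! i"
    using s by (auto simp: speeds_def)
  define h where "h = play least_loaded_fast B s n"
  define k where "k = least_loaded_fast s (loads s h)"
  have play_Suc: "play least_loaded_fast B s (Suc n) = h @ [(k, B h k)]"
    by (simp add: h_def k_def Let_def)
  let ?p = "B h k" and ?F = "fast_machines s"
  have p0: "0 \<le> ?p" using B by (simp add: adversaries_def)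
  have sum: "sum_list (map snd h) \<le> T * (\<Sum>i<m. s ! i)"
    using Suc.prems(1) p0 unfolding play_Suc by simp
  have IH: "load s h i \<le> (1 + 2 * sqrt m) * T"
    using Suc.IH Suc.prems(2) sum unfolding play_Suc h_def[symmetric] by auto
  have kF: "k \<in> ?F" unfolding k_def by (rule least_loaded_fast_spec(1)[OF s m])
  hence k: "k < m" "Max (set s) \<le> sqrt m * s ! k" using len by (auto simp: fast_machines_def)
  have F: "?F \<subseteq> {..<m}" using len by (auto simp: fast_machines_def)
  have h0: "\<forall>p\<in>snd ` set h. 0 \<le> p" unfolding h_def by (rule play_sizes_nonneg[OF B])
  have kmin: "load s h k \<le> load s h j" if "j \<in> ?F" for j
  proof -
    have "loads s h ! k \<le> loads s h ! j"
      unfolding k_def by (rule least_loaded_fast_spec(2)[OF s m that])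
    thus ?thesis using that k(1) F len by (simp add: loads_def subset_eq)
  qed
  \<comment> \<open>Averaging: if every fast machine has at least the load of \<open>k\<close>, the
    volume placed so far is at least this load times the total fast speed.\<close>
  have "load s h k * (\<Sum>j\<in>?F. s ! j) = (\<Sum>j\<in>?F. s ! j * load s h k)"
    by (simp add: sum_distrib_left mult.commute)
  also have "\<dots> \<le> (\<Sum>j\<in>?F. s ! j * load s h j)"
    using kmin F pos by (intro sum_mono mult_left_mono) (auto intro: less_imp_le)
  also have "\<dots> \<le> (\<Sum>j<m. s ! j * load s h j)"
    using F pos load_nonneg[OF h0]
    by (intro sum_mono2) (auto intro!: mult_nonneg_nonneg simp: less_imp_le)
  also have "\<dots> = sum_list (map snd h)"
    using sum_sizes_eq[of s h] pos len
      play_machines[OF least_loaded_fast_nonclairvoyant[OF m] s, of B n]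
    by (simp add: h_def)
  also have "\<dots> \<le> T * (\<Sum>i<m. s ! i)" by (rule sum)
  also have "\<dots> \<le> T * ((1 + sqrt m) * (\<Sum>j\<in>?F. s ! j))"
    using sum_speeds_le_fast[OF s m] T by (intro mult_left_mono) auto
  finally have "load s h k * (\<Sum>j\<in>?F. s ! j) \<le> ((1 + sqrt m) * T) * (\<Sum>j\<in>?F. s ! j)"
    by (simp add: mult_ac)
  moreover have "0 < (\<Sum>j\<in>?F. s ! j)" using kF F pos by (intro sum_pos) auto
  ultimately have low: "load s h k \<le> (1 + sqrt m) * T" by simp
  \<comment> \<open>The new job would take time at most \<open>T\<close> on the fastest machine, and
    \<open>k\<close> is slower by a factor of at most \<open>sqrt m\<close>.\<close>
  have "?p \<le> T * Max (set s)" using Suc.prems(2) unfolding play_Suc by simp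
  also have "\<dots> \<le> T * (sqrt m * s ! k)" using k T by (intro mult_left_mono) auto
  finally have "?p / s ! k \<le> sqrt m * T" using pos[OF k(1)] by (simp add: field_simps)
  with low IH show ?case
    unfolding play_Suc by (auto simp: load_append load_Cons algebra_simps)
qed

lemma makespan_ratio_least_loaded_fast_le:
  assumes s: "s \<in> speeds m" and m: "1 \<le> m" and B: "B \<in> adversaries"
  shows "makespan_ratio least_loaded_fast B s n \<le> 1 + 2 * sqrt m"
proof -
  let ?h = "play least_loaded_fast B s n"
  let ?T = "opt_makespan s (map snd ?h)"
  have "\<forall>p\<in>set (map snd ?h). 0 \<le> p" using play_sizes_nonneg[OF B] by simp
  note T = opt_makespan_lower_bounds[OF s m this]
  have "makespan s ?h \<le> (1 + 2 * sqrt m) * ?T"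
    using load_least_loaded_fast_le[OF s m B T(1,2)] T(3) m s
    by (intro makespan_le) (auto simp: speeds_def)
  \<comment> \<open>For optimum 0 the quotient is 0 by the convention for division.\<close>
  thus ?thesis using T(1)
    by (cases "?T = 0") (auto simp: makespan_ratio_def Let_def divide_le_eq)
qed

subsection \<open>Lower bound\<close>

text \<open>Speed \<open>sqrt m\<close> balances the two outcomes: \<open>m - 1\<close> unit jobs on
  machine 0 give load \<open>(m - 1) / sqrt m\<close>, and one job of size \<open>sqrt m\<close> on
  a slow machine gives load \<open>sqrt m\<close>.\<close>

definition one_fast_machine :: "nat \<Rightarrow> real list" where
  "one_fast_machine m = sqrt m # replicate (m - 1) 1"

text \<open>The size depends only on the chosen machine. Ending the play is left to the choice of
  the number of jobs.\<close>

definition punishing_adversary :: "nat \<Rightarrow> adversary" where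
  "punishing_adversary m h i = (if i = 0 then 1 else sqrt m)"

lemma one_fast_machine_speeds: "1 \<le> m \<Longrightarrow> one_fast_machine m \<in> speeds m"
  by (auto simp: one_fast_machine_def speeds_def nth_Cons split: nat.split)

lemma one_fast_machine_nth:
  "one_fast_machine m ! 0 = sqrt m" "0 < i \<Longrightarrow> i < m \<Longrightarrow> one_fast_machine m ! i = 1"
  by (auto simp: one_fast_machine_def)

lemma punishing_adversary_adversaries: "punishing_adversary m \<in> adversaries"
  by (simp add: adversaries_def punishing_adversary_def)

lemma play_all_on_0:
  assumes "\<forall>j<k. A s (loads s (play A (punishing_adversary m) s j)) = 0"
  shows "play A (punishing_adversary m) s k = replicate k (0, 1)"
  using assms
  by (induction k) (auto simp: Let_def punishing_adversary_def replicate_append_same)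

lemma load_replicate: "load s (replicate k (i, p)) i = k * (p / s ! i)"
  by (induction k) (auto simp: load_Cons algebra_simps add_divide_distrib)

text \<open>The job of positive size \<open>p\<close> forces a positive optimum and so excludes the
  quotient \<open>0 / 0\<close>; dividing by an optimum of at most 1 cannot decrease the
  load.\<close>

lemma makespan_ratio_ge:
  assumes s: "s \<in> speeds m" and m: "1 \<le> m" and h: "h = play A B s n" and B: "B \<in> adversaries"
    and i: "i < m" "c \<le> load s h i" "0 \<le> c"
    and opt: "opt_makespan s (map snd h) \<le> 1"
    and p: "p \<in> snd ` set h" "0 < p"
  shows "c \<le> makespan_ratio A B s n"
proof -
  let ?T = "opt_makespan s (map snd h)"
  have "\<forall>p\<in>set (map snd h). 0 \<le> p" using play_sizes_nonneg[OF B] h by simp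
  note T = opt_makespan_lower_bounds[OF s m this]
  have "?T \<noteq> 0" using T(3) p by auto
  hence "0 < ?T" using T(1) by simp
  moreover have "c \<le> makespan s h"
    using i load_le_makespan[of i s h] s by (auto simp: speeds_def)
  moreover have "c * ?T \<le> c * 1" using opt i by (intro mult_left_mono) auto
  ultimately show ?thesis by (simp add: makespan_ratio_def Let_def h[symmetric] field_simps)
qed

lemma makespan_ratio_punishing_adversary:
  assumes A: "A \<in> nonclairvoyant_algorithms m" and m: "2 \<le> m"
  shows "\<exists>n. (real m - 1) / sqrt m
           \<le> makespan_ratio A (punishing_adversary m) (one_fast_machine m) n"
proof -
  let ?s = "one_fast_machine m" and ?B = "punishing_adversary m"
  let ?next = "\<lambda>j. A ?s (loads ?s (play A ?B ?s j))"
  let ?c = "(real m - 1) / sqrt m"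
  have m1: "1 \<le> m" and c0: "0 \<le> ?c" using m by auto
  note s = one_fast_machine_speeds[OF m1]
  note B = punishing_adversary_adversaries[of m]
  show ?thesis
  proof (cases "\<exists>k<m - 1. ?next k \<noteq> 0")
    case False
    \<comment> \<open>As many unit jobs as there are slow machines: in hindsight each gets its
      own.\<close>
    define n where "n = m - 1"
    have h: "play A ?B ?s n = replicate n (0, 1)"
      using False by (intro play_all_on_0) (auto simp: n_def)
    have "opt_makespan ?s (replicate n 1) \<le> 1"
      by (rule opt_makespan_le_1[OF s m1, of "[1..<m]"])
        (auto simp: n_def one_fast_machine_nth)
    hence "?c \<le> makespan_ratio A ?B ?s n"
      using m by (intro makespan_ratio_ge[OF s m1 h[symmetric] B, of 0 _ 1])
        (auto simp: load_replicate one_fast_machine_nth n_def of_nat_diff)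
    thus ?thesis by blast
  next
    case True
    \<comment> \<open>The first step at which the algorithm leaves machine 0; all earlier jobs have
      size 1.\<close>
    then obtain k where k: "k < m - 1" "?next k \<noteq> 0" "\<forall>j<k. ?next j = 0"
      using exists_least_iff[of "\<lambda>k. k < m - 1 \<and> ?next k \<noteq> 0"] by (meson less_trans)
    define i where "i = ?next k"
    have i: "0 < i" "i < m"
      using k A s by (auto simp: i_def nonclairvoyant_algorithms_def loads_def speeds_def)
    have h: "play A ?B ?s (Suc k) = replicate k (0, 1) @ [(i, sqrt m)]"
      using play_all_on_0[OF k(3)] i by (simp add: Let_def i_def punishing_adversary_def)
    have "?s ! ([1..<Suc k] ! j) = 1" if "j < k" for j
      using that k(1) one_fast_machine_nth(2)[of "Suc j" m] by (subst nth_upt) auto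
    \<comment> \<open>In hindsight the unit jobs go to the slow machines 1 to \<open>k\<close> and
      the large job to machine 0.\<close>
    hence "opt_makespan ?s (replicate k 1 @ [sqrt m]) \<le> 1"
      using k(1) by (intro opt_makespan_le_1[OF s m1, of "[1..<Suc k] @ [0]"])
        (auto simp: one_fast_machine_nth nth_append less_Suc_eq simp del: upt_Suc)
    moreover have "?c \<le> sqrt m" using m by (simp add: field_simps)
    moreover have "0 \<le> load ?s (replicate k (0, 1)) i"
      using i s by (intro load_nonneg) (auto simp: speeds_def)
    ultimately have "?c \<le> makespan_ratio A ?B ?s (Suc k)"
      using m i c0 by (intro makespan_ratio_ge[OF s m1 h[symmetric] B, of i _ "sqrt m"])
        (auto simp: load_append load_Cons one_fast_machine_nth)
    thus ?thesis by blast
  qed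
qed

subsection \<open>The clairvoyance gap\<close>

lemma clairvoyance_gap_le:
  assumes "1 \<le> m"
  shows "clairvoyance_gap m \<le> ereal (1 + 2 * sqrt m)"
  unfolding clairvoyance_gap_def
  using assms makespan_ratio_least_loaded_fast_le
  by (intro INF_lower2[OF least_loaded_fast_nonclairvoyant] SUP_least) auto

text \<open>The infimum over algorithms is outermost, so speeds, adversary and number of jobs may
  depend on \<open>A\<close>.\<close>

lemma clairvoyance_gap_ge:
  assumes "\<And>A. A \<in> nonclairvoyant_algorithms m \<Longrightarrow>
    \<exists>s\<in>speeds m. \<exists>B\<in>adversaries. \<exists>n. c \<le> makespan_ratio A B s n"
  shows "ereal c \<le> clairvoyance_gap m"
  unfolding clairvoyance_gap_def
proof (rule INF_greatest)
  fix A assume "A \<in> nonclairvoyant_algorithms m"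
  then obtain s B n where "s \<in> speeds m" "B \<in> adversaries" "c \<le> makespan_ratio A B s n"
    using assms by blast
  thus "ereal c \<le> (SUP (s, n, B)\<in>speeds m \<times> UNIV \<times> adversaries. ereal (makespan_ratio A B s n))"
    by (intro SUP_upper2[of "(s, n, B)"]) auto
qed

text \<open>Excludes the value minus infinity, also for \<open>m = 1\<close>, which the quantitative
  lower bound leaves out.\<close>

lemma clairvoyance_gap_nonneg:
  assumes "1 \<le> m"
  shows "0 \<le> clairvoyance_gap m"
  using clairvoyance_gap_ge[of m 0] makespan_ratio_nonneg[OF one_fast_machine_speeds assms]
    one_fast_machine_speeds punishing_adversary_adversaries assms
  by (metis zero_ereal_def)

lemma clairvoyance_gap_lower:
  assumes "2 \<le> m"
  shows "ereal ((real m - 1) / sqrt m) \<le> clairvoyance_gap m"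
  using makespan_ratio_punishing_adversary one_fast_machine_speeds
    punishing_adversary_adversaries assms
  by (intro clairvoyance_gap_ge) (meson one_le_numeral order_trans)

lemma clairvoyance_gap_finite:
  assumes "1 \<le> m"
  shows "\<bar>clairvoyance_gap m\<bar> \<noteq> \<infinity>"
  using clairvoyance_gap_le[OF assms] clairvoyance_gap_nonneg[OF assms]
  by (cases "clairvoyance_gap m") auto

theorem theorem6:
  "(\<forall>m\<ge>1. \<bar>clairvoyance_gap m\<bar> \<noteq> \<infinity>) \<and>
   (\<lambda>m. real_of_ereal (clairvoyance_gap m)) \<in> \<Theta>(\<lambda>m. sqrt (real m))"
proof
  show "\<forall>m\<ge>1. \<bar>clairvoyance_gap m\<bar> \<noteq> \<infinity>" using clairvoyance_gap_finite by blast
  have bounds: "sqrt m / 2 \<le> real_of_ereal (clairvoyance_gap m)"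
    "real_of_ereal (clairvoyance_gap m) \<le> 3 * sqrt m" if m: "2 \<le> m" for m :: nat
  proof -
    have m1: "1 \<le> m" using m by simp
    obtain g where g: "clairvoyance_gap m = ereal g"
      using clairvoyance_gap_finite[OF m1] by auto
    \<comment> \<open>Equivalent to \<open>m / 2 \<le> m - 1\<close>, which is where
      \<open>2 \<le> m\<close> enters.\<close>
    have "sqrt m / 2 \<le> (real m - 1) / sqrt m" using m by (simp add: field_simps)
    also have "\<dots> \<le> g" using clairvoyance_gap_lower[OF m] g by simp
    finally show "sqrt m / 2 \<le> real_of_ereal (clairvoyance_gap m)" using g by simp
    have "g \<le> 1 + 2 * sqrt m" using clairvoyance_gap_le[OF m1] g by simp
    \<comment> \<open>Absorbs the additive 1, which yields the constant 3.\<close>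
    moreover have "1 \<le> sqrt m" using m by simp
    ultimately show "real_of_ereal (clairvoyance_gap m) \<le> 3 * sqrt m"
      unfolding g real_of_ereal.simps by linarith
  qed
  have "sqrt m / 2 \<le> \<bar>real_of_ereal (clairvoyance_gap m)\<bar>"
    "\<bar>real_of_ereal (clairvoyance_gap m)\<bar> \<le> 3 * sqrt m" if "2 \<le> m" for m :: nat
    using bounds[OF that] real_sqrt_ge_zero[of "real m"] by linarith+
  thus "(\<lambda>m. real_of_ereal (clairvoyance_gap m)) \<in> \<Theta>(\<lambda>m. sqrt (real m))"
    by (intro bigthetaI landau_o.bigI[of 3] landau_omega.bigI[of "1/2"]
        eventually_sequentiallyI[of 2]) auto
qed

end
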